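(* For every nonnegative integer $n$, the number of self-conjugate odd Ferrers graphs of weight $2n+1$ equals the number of self-conjugate partitions of $4n+1$ all of whose parts are odd. That is, $|\mathcal{O}_{2n+1}| = |\mathcal{S}_{4n+1}|$.
   Context: An odd Ferrers graph is the Ferrers diagram (rows of left-justified boxes, row lengths weakly decreasing from top to bottom) of a partition in which every box of the first row and every box of the first column contains the number 1, and every other box contains the number 2. The weight of an odd Ferrers graph is the sum of all the numbers in its boxes; equivalently, reading the row sums from top to bottom gives the partition it represents (e.g. the diagram with row lengths $7,4,2,1$ represents $7+7+3+1$, of weight $18$). An odd Ferrers graph is self-conjugate if its underlying Ferrers diagram (shape) is self-conjugate, i.e. equal to its transpose. $\mathcal{O}_{2n+1}$ denotes the set of self-conjugate odd Ferrers graphs of weight $2n+1$. $\mathcal{S}_{4n+1}$ denotes the set of self-conjugate partitions of $4n+1$ (partitions equal to their conjugate) in which every part is odd. *)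

theory Defs
  imports Main
begin

definition is_partition :: "nat list \<Rightarrow> bool" where
  "is_partition xs \<longleftrightarrow> sorted_wrt (\<ge>) xs \<and> 0 \<notin> set xs"

text \<open>The box \<open>(i, j)\<close> lies in row \<open>i\<close> (from the top) and column \<open>j\<close> (from the left),
  both counted from 0.\<close>

definition ferrers_diagram :: "nat list \<Rightarrow> (nat \<times> nat) set" where
  "ferrers_diagram xs = {(i, j). i < length xs \<and> j < xs ! i}"

text \<open>The \<open>j\<close>-th part of the conjugate is the length of column \<open>j\<close>; \<open>foldr max xs 0\<close> is the
  largest part (0 for the empty partition).\<close>

definition conjugate :: "nat list \<Rightarrow> nat list" where
  "conjugate xs = map (\<lambda>j. card {i. (i, j) \<in> ferrers_diagram xs}) [0..<foldr max xs 0]"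

text \<open>A numbered diagram is a partial map from boxes to numbers, whose domain is the underlying
  shape.\<close>

definition odd_ferrers_graph :: "(nat \<times> nat \<Rightarrow> nat option) \<Rightarrow> bool" where
  "odd_ferrers_graph T \<longleftrightarrow>
     (\<exists>xs. is_partition xs \<and> dom T = ferrers_diagram xs) \<and>
     (\<forall>(i, j) \<in> dom T. T (i, j) = Some (if i = 0 \<or> j = 0 then 1 else 2))"

definition weight :: "(nat \<times> nat \<Rightarrow> nat option) \<Rightarrow> nat" where
  "weight T = (\<Sum>b\<in>dom T. the (T b))"

definition self_conjugate_graph :: "(nat \<times> nat \<Rightarrow> nat option) \<Rightarrow> bool" where
  "self_conjugate_graph T \<longleftrightarrow> prod.swap ` dom T = dom T"

definition self_conjugate_odd_ferrers_graphs :: "nat \<Rightarrow> (nat \<times> nat \<Rightarrow> nat option) set" where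
  "self_conjugate_odd_ferrers_graphs m =
     {T. odd_ferrers_graph T \<and> self_conjugate_graph T \<and> weight T = m}"

definition self_conjugate_odd_part_partitions :: "nat \<Rightarrow> nat list set" where
  "self_conjugate_odd_part_partitions m =
     {xs. is_partition xs \<and> sum_list xs = m \<and> conjugate xs = xs \<and> (\<forall>p\<in>set xs. odd p)}"

lemma finite_ferrers_diagram: "finite (ferrers_diagram xs)"
proof -
  have "ferrers_diagram xs = (SIGMA i:{..<length xs}. {..<xs ! i})"
    by (auto simp: ferrers_diagram_def)
  then show ?thesis by simp
qed

lemma le_foldr_max: "p \<in> set xs \<Longrightarrow> p \<le> foldr max xs (0::nat)"
  by (induction xs) auto

text \<open>The conjugate of a partition is the partition with the transposed diagram.\<close>

lemma ferrers_diagram_conjugate: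
  assumes "is_partition xs"
  shows "ferrers_diagram (conjugate xs) = prod.swap ` ferrers_diagram xs"
proof -
  have col: "i < card {i. (i, j) \<in> ferrers_diagram xs} \<longleftrightarrow> (i, j) \<in> ferrers_diagram xs" for i j
  proof -
    let ?C = "{i. (i, j) \<in> ferrers_diagram xs}"
    have dc: "a \<in> ?C" if "b \<in> ?C" "a \<le> b" for a b
    proof (cases "a = b")
      case False
      then have "xs ! b \<le> xs ! a"
        using that assms sorted_wrt_nth_less[of "(\<ge>)" xs a b]
        by (auto simp: is_partition_def ferrers_diagram_def)
      then show ?thesis using that by (auto simp: ferrers_diagram_def)
    qed (use that in simp)
    have fin: "finite ?C"
      by (rule finite_subset[of _ "{..<length xs}"]) (auto simp: ferrers_diagram_def)
    show ?thesis
    proof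
      assume lt: "i < card ?C"
      show "(i, j) \<in> ferrers_diagram xs"
      proof (rule ccontr)
        assume n: "(i, j) \<notin> ferrers_diagram xs"
        have "?C \<subseteq> {..<i}"
        proof
          fix b assume "b \<in> ?C"
          then show "b \<in> {..<i}" using dc[of b i] n by (cases "i \<le> b") auto
        qed
        then have "card ?C \<le> i" using card_mono[of "{..<i}" ?C] by simp
        with lt show False by simp
      qed
    next
      assume "(i, j) \<in> ferrers_diagram xs"
      then have "{..i} \<subseteq> ?C" using dc[of i] by auto
      then have "Suc i \<le> card ?C" using card_mono[OF fin, of "{..i}"] by simp
      then show "i < card ?C" by simp
    qed
  qed
  have bound: "j < foldr max xs 0" if "(i, j) \<in> ferrers_diagram xs" for i j
    using that le_foldr_max[of "xs ! i" xs] by (auto simp: ferrers_diagram_def)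
  show ?thesis
  proof (intro set_eqI)
    fix x :: "nat \<times> nat"
    obtain j i where x: "x = (j, i)" by (cases x)
    have "x \<in> ferrers_diagram (conjugate xs) \<longleftrightarrow>
        j < foldr max xs 0 \<and> i < card {i. (i, j) \<in> ferrers_diagram xs}"
      by (auto simp: x conjugate_def ferrers_diagram_def[of "map _ _"])
    also have "\<dots> \<longleftrightarrow> (i, j) \<in> ferrers_diagram xs" using col bound by blast
    also have "\<dots> \<longleftrightarrow> x \<in> prod.swap ` ferrers_diagram xs"
      by (force simp: x)
    finally show "x \<in> ferrers_diagram (conjugate xs) \<longleftrightarrow> x \<in> prod.swap ` ferrers_diagram xs" .
  qed
qed

lemma odd_ferrers_graph_entry:
  assumes "odd_ferrers_graph T" "(i, j) \<in> dom T"
  shows "T (i, j) = Some (if i = 0 \<or> j = 0 then 1 else 2)"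
proof -
  have "\<forall>(i, j) \<in> dom T. T (i, j) = Some (if i = 0 \<or> j = 0 then 1 else 2)"
    using assms(1) unfolding odd_ferrers_graph_def by (rule conjunct2)
  from bspec[OF this assms(2)] show ?thesis by (simp only: prod.case)
qed

text \<open>Both sets are finite, so \<open>card\<close> counts their elements.\<close>

lemma finite_self_conjugate_odd_ferrers_graphs: "finite (self_conjugate_odd_ferrers_graphs m)"
proof (rule finite_imageD[of dom])
  let ?A = "self_conjugate_odd_ferrers_graphs m"
  have "dom T \<subseteq> {..<m} \<times> {..<m}" if T: "T \<in> ?A" for T
  proof
    fix b assume b: "b \<in> dom T"
    obtain i j where ij: "b = (i, j)" by (cases b)
    have odd: "odd_ferrers_graph T" and w: "(\<Sum>b\<in>dom T. the (T b)) = m"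
      using T by (simp_all add: self_conjugate_odd_ferrers_graphs_def weight_def)
    obtain xs where xs: "is_partition xs" "dom T = ferrers_diagram xs"
      using conjunct1[OF odd[unfolded odd_ferrers_graph_def]] by blast
    note v = odd_ferrers_graph_entry[OF odd]
    have fin: "finite (dom T)" using xs finite_ferrers_diagram by simp
    have "card (dom T) = (\<Sum>b\<in>dom T. 1)" by simp
    also have "\<dots> \<le> (\<Sum>b\<in>dom T. the (T b))"
    proof (rule sum_mono)
      fix c assume "c \<in> dom T"
      then show "1 \<le> the (T c)" using v[of "fst c" "snd c"] by (simp split: if_splits)
    qed
    finally have cm: "card (dom T) \<le> m" using w by simp
    have bx: "i < length xs" "j < xs ! i" using b ij xs by (auto simp: ferrers_diagram_def)
    have "Pair i ` {..j} \<subseteq> dom T" using bx xs by (auto simp: ferrers_diagram_def)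
    then have "card (Pair i ` {..j}) \<le> m" using card_mono[OF fin] cm by (metis order_trans)
    then have "j < m" by (simp add: card_image inj_on_def)
    moreover have "(\<lambda>k. (k, 0)) ` {..i} \<subseteq> dom T"
      using bx(1) xs by (auto simp: ferrers_diagram_def is_partition_def in_set_conv_nth)
    then have "card ((\<lambda>k. (k, 0::nat)) ` {..i}) \<le> m" using card_mono[OF fin] cm by (metis order_trans)
    then have "i < m" by (simp add: card_image inj_on_def)
    ultimately show "b \<in> {..<m} \<times> {..<m}" by (simp add: ij)
  qed
  then have "dom ` ?A \<subseteq> Pow ({..<m} \<times> {..<m})" by blast
  then show "finite (dom ` ?A)" by (rule finite_subset) simp
  show "inj_on dom ?A"
  proof (rule inj_onI)
    fix T U assume TU: "T \<in> ?A" "U \<in> ?A" "dom T = dom U"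
    show "T = U"
    proof
      fix b
      show "T b = U b"
      proof (cases "b \<in> dom T")
        case True
        then show ?thesis
          using TU odd_ferrers_graph_entry[of T "fst b" "snd b"]
            odd_ferrers_graph_entry[of U "fst b" "snd b"]
          by (simp add: self_conjugate_odd_ferrers_graphs_def)
      next
        case False
        then show ?thesis using TU(3) by (metis domIff)
      qed
    qed
  qed
qed

lemma finite_self_conjugate_odd_part_partitions: "finite (self_conjugate_odd_part_partitions m)"
proof (rule finite_subset)
  have len: "length xs \<le> sum_list xs" if "0 \<notin> set xs" for xs :: "nat list"
    using that by (induction xs) auto
  show "self_conjugate_odd_part_partitions m \<subseteq> {xs. set xs \<subseteq> {..m} \<and> length xs \<le> m}"
    using len by (auto simp: self_conjugate_odd_part_partitions_def is_partition_def
        dest: member_le_sum_list)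
qed (rule finite_lists_length_le, simp)

end

theory Submission imports Defs begin

text \<open>Replace each row and each column of a shape other than the first ones by two copies of
  itself. The corner box stays single, a further box of the first row or column becomes two boxes
  and any other box becomes four, so each box numbered \<open>w\<close> becomes \<open>2 * w\<close> boxes, except for the
  corner, which is one short: weight \<open>2 * n + 1\<close> becomes size \<open>2 * (2 * n + 1) - 1 = 4 * n + 1\<close>.
  The symmetric shapes that arise in this way are exactly those with odd rows, since a row of odd
  length that contains column \<open>2 * k + 1\<close> also contains column \<open>2 * k + 2\<close>.\<close>

section \<open>Young diagrams as down-closed sets of boxes\<close>

text \<open>Shapes are characterised without a list of parts, so that the doubling of rows and
  columns can act on bare sets of boxes.\<close>

definition young_diagram :: "(nat \<times> nat) set \<Rightarrow> bool" where
  "young_diagram D \<longleftrightarrow>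
     finite D \<and> (\<forall>i j i' j'. (i, j) \<in> D \<longrightarrow> i' \<le> i \<longrightarrow> j' \<le> j \<longrightarrow> (i', j') \<in> D)"

lemma young_diagramD:
  "young_diagram D \<Longrightarrow> (i, j) \<in> D \<Longrightarrow> i' \<le> i \<Longrightarrow> j' \<le> j \<Longrightarrow> (i', j') \<in> D"
  unfolding young_diagram_def by blast

lemma young_diagram_finite: "young_diagram D \<Longrightarrow> finite D"
  unfolding young_diagram_def by blast

text \<open>Any \<open>b\<close> in \<open>A\<close> brings along all of \<open>{..b}\<close>, hence
  \<open>b < card A\<close>. So \<open>A\<close> lies inside a set of its own finite cardinality and
  fills it.\<close>

lemma down_closed_eq_lessThan_card:
  fixes A :: "nat set"
  assumes "finite A" "\<And>a b. b \<in> A \<Longrightarrow> a \<le> b \<Longrightarrow> a \<in> A"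
  shows "A = {..<card A}"
proof -
  have "A \<subseteq> {..<card A}"
  proof
    fix b assume "b \<in> A"
    then have "{..b} \<subseteq> A" using assms(2) by auto
    then have "Suc b \<le> card A" using card_mono[OF assms(1), of "{..b}"] by simp
    then show "b \<in> {..<card A}" by simp
  qed
  then show ?thesis by (intro card_subset_eq) auto
qed

lemma young_diagram_row:
  assumes "young_diagram D"
  shows "{j. (i, j) \<in> D} = {..<card {j. (i, j) \<in> D}}"
proof (rule down_closed_eq_lessThan_card)
  have "{j. (i, j) \<in> D} \<subseteq> snd ` D" by force
  then show "finite {j. (i, j) \<in> D}"
    using young_diagram_finite[OF assms] finite_subset by blast
qed (use young_diagramD[OF assms] in blast)

lemma young_diagram_first_column:
  assumes "young_diagram D"
  shows "{i. (i, 0) \<in> D} = {..<card {i. (i, 0) \<in> D}}"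
proof (rule down_closed_eq_lessThan_card)
  have "{i. (i, 0) \<in> D} \<subseteq> fst ` D" by force
  then show "finite {i. (i, 0) \<in> D}"
    using young_diagram_finite[OF assms] finite_subset by blast
qed (use young_diagramD[OF assms] in blast)

lemma partition_antimono:
  "is_partition xs \<Longrightarrow> i' \<le> i \<Longrightarrow> i < length xs \<Longrightarrow> xs ! i \<le> xs ! i'"
  using sorted_wrt_nth_less[of "(\<ge>)" xs i' i]
  by (cases "i' = i") (auto simp: is_partition_def)

lemma partition_nth_pos: "is_partition xs \<Longrightarrow> i < length xs \<Longrightarrow> 0 < xs ! i"
  unfolding is_partition_def by (metis gr0I nth_mem)

lemma young_diagram_ferrers_diagram:
  assumes "is_partition xs"
  shows "young_diagram (ferrers_diagram xs)"
  unfolding young_diagram_def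
proof (intro conjI allI impI)
  fix i j i' j'
  assume "(i, j) \<in> ferrers_diagram xs" "i' \<le> i" "j' \<le> j"
  then show "(i', j') \<in> ferrers_diagram xs"
    using partition_antimono[OF assms, of i' i] by (simp add: ferrers_diagram_def)
qed (rule finite_ferrers_diagram)

lemma ferrers_diagram_row: "i < length xs \<Longrightarrow> {j. (i, j) \<in> ferrers_diagram xs} = {..<xs ! i}"
  by (auto simp: ferrers_diagram_def)

lemma ferrers_diagram_first_column:
  "is_partition xs \<Longrightarrow> {i. (i, 0) \<in> ferrers_diagram xs} = {..<length xs}"
  using partition_nth_pos by (auto simp: ferrers_diagram_def)

text \<open>Since no part is zero, the first column recovers the number of parts; each row then
  recovers its part.\<close>

lemma inj_on_ferrers_diagram: "inj_on ferrers_diagram {xs. is_partition xs}"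
proof (rule inj_onI, clarsimp)
  fix xs ys
  assume p: "is_partition xs" "is_partition ys" and eq: "ferrers_diagram xs = ferrers_diagram ys"
  have len: "length xs = length ys"
    using ferrers_diagram_first_column[OF p(1)] ferrers_diagram_first_column[OF p(2)] eq by simp
  show "xs = ys"
  proof (rule nth_equalityI[OF len])
    fix i assume "i < length xs"
    then show "xs ! i = ys ! i"
      using ferrers_diagram_row[of i xs] ferrers_diagram_row[of i ys] eq len by simp
  qed
qed

text \<open>The parts are the row lengths, listed up to the length of the first column, which is
  where they become 0.\<close>

lemma young_diagram_imp_ferrers_diagram:
  assumes "young_diagram D"
  shows "\<exists>xs. is_partition xs \<and> ferrers_diagram xs = D"
proof -
  define r where "r i = card {j. (i, j) \<in> D}" for i
  define l where "l = card {i. (i, 0) \<in> D}"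
  have row: "(i, j) \<in> D \<longleftrightarrow> j < r i" for i j
    using young_diagram_row[OF assms, of i] unfolding r_def by blast
  have col: "(i, 0) \<in> D \<longleftrightarrow> i < l" for i
    using young_diagram_first_column[OF assms] unfolding l_def by blast
  have anti: "r i \<le> r i'" if "i' \<le> i" for i i'
  proof (rule ccontr)
    assume "\<not> r i \<le> r i'"
    \<comment> \<open>The first box beyond row \<open>i'\<close> would lie in the longer lower row
      \<open>i\<close>, and closure would put it into row \<open>i'\<close> as well.\<close>
    then have "(i', r i') \<in> D" using row young_diagramD[OF assms, of i "r i'" i' "r i'"] that by simp
    then show False using row by simp
  qed
  define xs where "xs = map r [0..<l]"
  have pos: "r i = 0 \<longleftrightarrow> l \<le> i" for i
    using row[of i 0] col[of i] by auto
  have "0 \<notin> set xs"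
  proof
    assume "0 \<in> set xs"
    then obtain i where "i < l" "r i = 0" by (auto simp: xs_def)
    then show False using pos[of i] by simp
  qed
  moreover have "sorted_wrt (\<ge>) xs"
    unfolding xs_def sorted_wrt_iff_nth_less by (simp add: anti)
  ultimately have "is_partition xs" by (simp add: is_partition_def)
  moreover have "(i, j) \<in> ferrers_diagram xs \<longleftrightarrow> (i, j) \<in> D" for i j
    using row[of i j] pos[of i] by (auto simp: xs_def ferrers_diagram_def)
  then have "ferrers_diagram xs = D" by auto
  ultimately show ?thesis by blast
qed

lemma sum_list_eq_card_ferrers_diagram: "sum_list xs = card (ferrers_diagram xs)"
proof -
  have "ferrers_diagram xs = (SIGMA i:{..<length xs}. {..<xs ! i})"
    by (auto simp: ferrers_diagram_def)
  then show ?thesis by (simp add: sum_list_sum_nth atLeast0LessThan)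
qed

lemma is_partition_conjugate:
  assumes "is_partition xs"
  shows "is_partition (conjugate xs)"
proof -
  let ?C = "\<lambda>j. {i. (i, j) \<in> ferrers_diagram xs}"
  have fin: "finite (?C j)" for j
    by (rule finite_subset[of _ "{..<length xs}"]) (auto simp: ferrers_diagram_def)
  have "card (?C j) \<le> card (?C j')" if "j' \<le> j" for j j'
    by (rule card_mono[OF fin]) (use that in \<open>auto simp: ferrers_diagram_def\<close>)
  moreover have "card (?C j) \<noteq> 0" if j: "j < foldr max xs 0" for j
  proof -
    have "\<exists>p\<in>set xs. j < p" using j by (induction xs) (auto simp: less_max_iff_disj)
    then have "?C j \<noteq> {}" by (auto simp: ferrers_diagram_def in_set_conv_nth)
    then show ?thesis using fin by simp
  qed
  ultimately show ?thesis
    by (force simp: is_partition_def conjugate_def sorted_wrt_iff_nth_less)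
qed

text \<open>The conjugate is itself a partition, so equality of lists may be tested on the diagrams,
  where conjugation is transposition.\<close>

lemma conjugate_eq_self_iff:
  assumes "is_partition xs"
  shows "conjugate xs = xs \<longleftrightarrow> prod.swap ` ferrers_diagram xs = ferrers_diagram xs"
  using inj_onD[OF inj_on_ferrers_diagram, of "conjugate xs" xs]
    ferrers_diagram_conjugate[OF assms] is_partition_conjugate[OF assms] assms
  by auto

text \<open>Quantifying over boxes skips the empty rows, whose length 0 is even. Conversely, each
  part is positive, so its row has a box in column 0.\<close>

lemma odd_parts_iff:
  assumes "is_partition xs"
  shows "(\<forall>p\<in>set xs. odd p) \<longleftrightarrow>
    (\<forall>(i, j)\<in>ferrers_diagram xs. odd (card {j. (i, j) \<in> ferrers_diagram xs}))"
    (is "?L \<longleftrightarrow> ?R")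
proof
  assume ?L
  then show ?R
    using ferrers_diagram_row[of _ xs] by (auto simp: ferrers_diagram_def)
next
  assume R: ?R
  show ?L
  proof
    fix p assume "p \<in> set xs"
    then obtain i where i: "i < length xs" "p = xs ! i" by (auto simp: in_set_conv_nth)
    then have "(i, 0) \<in> ferrers_diagram xs"
      using partition_nth_pos[OF assms] by (simp add: ferrers_diagram_def)
    then show "odd p" using R i ferrers_diagram_row[of i xs] by fastforce
  qed
qed

section \<open>Reduction of both families to sets of shapes\<close>

definition box_number :: "nat \<times> nat \<Rightarrow> nat" where
  "box_number b = (if fst b = 0 \<or> snd b = 0 then 1 else 2)"

definition symmetric_shapes :: "nat \<Rightarrow> (nat \<times> nat) set set" where
  "symmetric_shapes m =
     {D. young_diagram D \<and> prod.swap ` D = D \<and> sum box_number D = m}"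

definition symmetric_odd_row_shapes :: "nat \<Rightarrow> (nat \<times> nat) set set" where
  "symmetric_odd_row_shapes m =
     {D. young_diagram D \<and> card D = m \<and> prod.swap ` D = D \<and>
       (\<forall>(i, j)\<in>D. odd (card {j. (i, j) \<in> D}))}"

text \<open>The position of a box forces its number, so a graph carries no information beyond its
  shape.\<close>

lemma odd_ferrers_graph_iff:
  "odd_ferrers_graph T \<longleftrightarrow>
     young_diagram (dom T) \<and> T = (\<lambda>b. if b \<in> dom T then Some (box_number b) else None)"
proof -
  have shape: "(\<exists>xs. is_partition xs \<and> dom T = ferrers_diagram xs) \<longleftrightarrow> young_diagram (dom T)"
    by (metis young_diagram_ferrers_diagram young_diagram_imp_ferrers_diagram)
  have "(\<forall>(i, j)\<in>dom T. T (i, j) = Some (if i = 0 \<or> j = 0 then 1 else 2)) \<longleftrightarrow>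
      (\<forall>b\<in>dom T. T b = Some (box_number b))"
    by (simp add: box_number_def case_prod_beta)
  also have "\<dots> \<longleftrightarrow> T = (\<lambda>b. if b \<in> dom T then Some (box_number b) else None)"
    unfolding fun_eq_iff by (metis domIff)
  finally show ?thesis unfolding odd_ferrers_graph_def shape by (rule arg_cong)
qed

lemma bij_betw_graphs_shapes:
  "bij_betw dom (self_conjugate_odd_ferrers_graphs m) (symmetric_shapes m)"
proof (rule bij_betw_byWitness
    [where f' = "\<lambda>D b. if b \<in> D then Some (box_number b) else None"])
  let ?g = "\<lambda>D b. if b \<in> D then Some (box_number b) else None"
  have dom_g: "dom (?g D) = D" for D by (auto simp: dom_def)
  have weight: "weight (?g D) = sum box_number D" for D
    unfolding weight_def dom_g by (rule sum.cong) auto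
  show "\<forall>T\<in>self_conjugate_odd_ferrers_graphs m. ?g (dom T) = T"
    unfolding self_conjugate_odd_ferrers_graphs_def odd_ferrers_graph_iff by (blast intro: sym)
  show "\<forall>D\<in>symmetric_shapes m. dom (?g D) = D" using dom_g by blast
  show "dom ` self_conjugate_odd_ferrers_graphs m \<subseteq> symmetric_shapes m"
  proof (rule image_subsetI)
    fix T assume T: "T \<in> self_conjugate_odd_ferrers_graphs m"
    then have "T = ?g (dom T)" and "weight T = m"
      unfolding self_conjugate_odd_ferrers_graphs_def odd_ferrers_graph_iff by blast+
    then have "sum box_number (dom T) = m" using weight by metis
    then show "dom T \<in> symmetric_shapes m"
      using T unfolding self_conjugate_odd_ferrers_graphs_def odd_ferrers_graph_iff
        self_conjugate_graph_def symmetric_shapes_def by blast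
  qed
  show "?g ` symmetric_shapes m \<subseteq> self_conjugate_odd_ferrers_graphs m"
    by (rule image_subsetI)
      (simp add: self_conjugate_odd_ferrers_graphs_def odd_ferrers_graph_iff
        self_conjugate_graph_def symmetric_shapes_def dom_g weight)
qed

lemma bij_betw_partitions_shapes:
  "bij_betw ferrers_diagram (self_conjugate_odd_part_partitions m) (symmetric_odd_row_shapes m)"
proof -
  have iff: "xs \<in> self_conjugate_odd_part_partitions m \<longleftrightarrow>
      ferrers_diagram xs \<in> symmetric_odd_row_shapes m" if "is_partition xs" for xs
    using that unfolding self_conjugate_odd_part_partitions_def symmetric_odd_row_shapes_def
    by (simp add: conjugate_eq_self_iff odd_parts_iff sum_list_eq_card_ferrers_diagram
        young_diagram_ferrers_diagram)
  have part: "is_partition xs" if "xs \<in> self_conjugate_odd_part_partitions m" for xs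
    using that by (simp add: self_conjugate_odd_part_partitions_def)
  show ?thesis
    unfolding bij_betw_def
  proof
    show "inj_on ferrers_diagram (self_conjugate_odd_part_partitions m)"
      by (rule inj_on_subset[OF inj_on_ferrers_diagram]) (use part in blast)
    show "ferrers_diagram ` self_conjugate_odd_part_partitions m = symmetric_odd_row_shapes m"
    proof (intro subset_antisym subsetI)
      fix D assume "D \<in> ferrers_diagram ` self_conjugate_odd_part_partitions m"
      then show "D \<in> symmetric_odd_row_shapes m" using iff part by auto
    next
      fix D assume D: "D \<in> symmetric_odd_row_shapes m"
      then have "young_diagram D" by (simp add: symmetric_odd_row_shapes_def)
      then obtain xs where xs: "is_partition xs" "ferrers_diagram xs = D"
        using young_diagram_imp_ferrers_diagram by blast
      then have "xs \<in> self_conjugate_odd_part_partitions m" using iff D by simp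
      then show "D \<in> ferrers_diagram ` self_conjugate_odd_part_partitions m"
        using xs(2) by (rule rev_image_eqI[OF _ sym])
    qed
  qed
qed

section \<open>Doubling rows and columns, and its inverse\<close>

text \<open>The indices \<open>0, 1, 2, 3, 4, \<dots>\<close> of rows or columns are copies of \<open>0, 1, 1, 2, 2, \<dots>\<close>.\<close>

definition block :: "nat \<Rightarrow> nat" where
  "block i = (i + 1) div 2"

definition blow_up :: "(nat \<times> nat) set \<Rightarrow> (nat \<times> nat) set" where
  "blow_up D = map_prod block block -` D"

text \<open>The index \<open>2 * i\<close> is the last copy of \<open>i\<close>. In a Young diagram,
  containing the box of last copies means containing all copies of \<open>(i, j)\<close>.\<close>

definition shrink :: "(nat \<times> nat) set \<Rightarrow> (nat \<times> nat) set" where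
  "shrink E = {(i, j). (2 * i, 2 * j) \<in> E}"

lemma in_blow_up [simp]: "(i, j) \<in> blow_up D \<longleftrightarrow> (block i, block j) \<in> D"
  by (simp add: blow_up_def)

lemma in_shrink [simp]: "(i, j) \<in> shrink E \<longleftrightarrow> (2 * i, 2 * j) \<in> E"
  by (simp add: shrink_def)

lemma block_double [simp]: "block (2 * i) = i"
  by (simp add: block_def)

lemma block_mono: "i \<le> j \<Longrightarrow> block i \<le> block j"
  by (simp add: block_def div_le_mono)

lemma vimage_block: "block -` {i} = (if i = 0 then {0} else {2 * i - 1, 2 * i})"
proof -
  have "block k = i \<longleftrightarrow> (if i = 0 then k = 0 else k = 2 * i - 1 \<or> k = 2 * i)" for k
    unfolding block_def by presburger
  then show ?thesis by (simp add: set_eq_iff)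
qed

lemma swap_image_eq_iff: "prod.swap ` D = D \<longleftrightarrow> (\<forall>i j. (i, j) \<in> D \<longleftrightarrow> (j, i) \<in> D)"
proof -
  have "(j, i) \<in> prod.swap ` D \<longleftrightarrow> (i, j) \<in> D" for i j by force
  then show ?thesis unfolding set_eq_iff by (metis surj_pair)
qed

lemma swap_image_blow_up: "prod.swap ` D = D \<Longrightarrow> prod.swap ` blow_up D = blow_up D"
  unfolding swap_image_eq_iff in_blow_up by blast

lemma swap_image_shrink: "prod.swap ` E = E \<Longrightarrow> prod.swap ` shrink E = shrink E"
  unfolding swap_image_eq_iff in_shrink by blast

lemma vimage_block_pair:
  "map_prod block block -` {(i, j)} = block -` {i} \<times> block -` {j}"
  by auto

lemma blow_up_eq_UN: "blow_up D = (\<Union>b\<in>D. map_prod block block -` {b})"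
  unfolding blow_up_def by (rule vimage_eq_UN)

lemma finite_blow_up: "finite D \<Longrightarrow> finite (blow_up D)"
  by (auto simp: blow_up_eq_UN vimage_block_pair vimage_block)

lemma young_diagram_blow_up:
  assumes "young_diagram D"
  shows "young_diagram (blow_up D)"
  unfolding young_diagram_def in_blow_up
  using finite_blow_up[OF young_diagram_finite[OF assms]]
    young_diagramD[OF assms _ block_mono block_mono] by blast

lemma young_diagram_shrink:
  assumes "young_diagram E"
  shows "young_diagram (shrink E)"
proof -
  have "shrink E = map_prod ((*) 2) ((*) 2) -` E"
    by auto
  then have "finite (shrink E)"
    using young_diagram_finite[OF assms] by (simp add: finite_vimageI inj_on_def)
  then show ?thesis
    unfolding young_diagram_def in_shrink
    using young_diagramD[OF assms] mult_le_mono2 by blast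
qed

section \<open>Size and row parity of the doubled shape\<close>

text \<open>The fibres over distinct boxes are disjoint and have \<open>2 * box_number b\<close>
  elements, except that the corner has one copy instead of two. The \<open>+ 1\<close> makes up for
  that missing copy.\<close>

lemma card_blow_up:
  assumes "finite D" "(0, 0) \<in> D"
  shows "card (blow_up D) + 1 = 2 * sum box_number D"
proof -
  let ?f = "\<lambda>b. card (map_prod block block -` {b})"
  have f: "?f b = (if b = (0, 0) then 1 else 2 * box_number b)" for b
    by (cases b) (auto simp: vimage_block_pair vimage_block box_number_def card_cartesian_product)
  have "card (blow_up D) = sum ?f D"
    unfolding blow_up_eq_UN
    by (intro card_UN_disjoint assms(1)) (auto simp: vimage_block_pair vimage_block)
  also have "\<dots> = 1 + (\<Sum>b\<in>D - {(0, 0)}. 2 * box_number b)"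
    using assms by (simp add: f sum.remove)
  finally show ?thesis
    using assms by (simp add: sum_distrib_left sum.remove[of D "(0, 0)"] box_number_def)
qed

text \<open>A row of length \<open>r > 0\<close> keeps its first box and doubles the other
  \<open>r - 1\<close>, which gives length \<open>2 * r - 1\<close>.\<close>

lemma odd_rows_blow_up:
  assumes "young_diagram D" "(i, j) \<in> blow_up D"
  shows "odd (card {j. (i, j) \<in> blow_up D})"
proof -
  define r where "r = card {j. (block i, j) \<in> D}"
  have row: "(block i, j) \<in> D \<longleftrightarrow> j < r" for j
    using young_diagram_row[OF assms(1), of "block i"] unfolding r_def by blast
  have "block j < r" using assms(2) row by simp
  \<comment> \<open>For \<open>r = 0\<close> the truncated difference \<open>2 * r - 1\<close> would
    be 0, which is even.\<close>
  then have pos: "0 < r" by simp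
  have "{j. (i, j) \<in> blow_up D} = {..<2 * r - 1}"
  proof (rule set_eqI)
    fix j
    have "block j < r \<longleftrightarrow> j < 2 * r - 1" unfolding block_def by presburger
    then show "j \<in> {j. (i, j) \<in> blow_up D} \<longleftrightarrow> j \<in> {..<2 * r - 1}" using row by simp
  qed
  then show ?thesis using pos by simp
qed

section \<open>The bijection between the two sets of shapes\<close>

lemma shrink_blow_up: "shrink (blow_up D) = D"
  by auto

text \<open>Odd row lengths allow a column index to be rounded up to the last copy in its block;
  symmetry gives the same for row indices.\<close>

lemma blow_up_shrink:
  assumes "young_diagram E" "prod.swap ` E = E"
    and odd: "\<And>i j. (i, j) \<in> E \<Longrightarrow> odd (card {j. (i, j) \<in> E})"
  shows "blow_up (shrink E) = E"
proof -
  have column: "(i, 2 * block j) \<in> E" if ij: "(i, j) \<in> E" for i j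
  proof -
    define r where "r = card {j. (i, j) \<in> E}"
    have row: "(i, j) \<in> E \<longleftrightarrow> j < r" for j
      using young_diagram_row[OF assms(1), of i] unfolding r_def by blast
    have "j < r" using ij row by simp
    moreover have "odd r" using odd ij unfolding r_def by blast
    \<comment> \<open>\<open>2 * block j\<close> is \<open>j\<close> for even \<open>j\<close> and
      \<open>j + 1\<close> for odd \<open>j\<close>; in the latter case \<open>j + 1 = r\<close> is
      excluded by parity.\<close>
    ultimately have "2 * block j < r" unfolding block_def by presburger
    then show ?thesis using row by simp
  qed
  have sym: "(i, j) \<in> E \<longleftrightarrow> (j, i) \<in> E" for i j
    using assms(2) by (simp add: swap_image_eq_iff)
  have le: "i \<le> 2 * block i" for i
    unfolding block_def by presburger
  have "(2 * block i, 2 * block j) \<in> E \<longleftrightarrow> (i, j) \<in> E" for i j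
  proof
    assume "(i, j) \<in> E"
    \<comment> \<open>Round up the column index, transpose, then round up the other index and
      transpose back.\<close>
    then have "(2 * block j, i) \<in> E" using column sym by metis
    then show "(2 * block i, 2 * block j) \<in> E" using column sym by metis
  qed (rule young_diagramD[OF assms(1) _ le le])
  then show ?thesis by auto
qed

lemma bij_betw_blow_up:
  "bij_betw blow_up (symmetric_shapes (2 * n + 1)) (symmetric_odd_row_shapes (4 * n + 1))"
proof (rule bij_betw_byWitness[where f' = shrink])
  have corner: "(0, 0) \<in> D" if "young_diagram D" "D \<noteq> {}" for D
  proof -
    obtain i j where "(i, j) \<in> D" using \<open>D \<noteq> {}\<close> by auto
    then show ?thesis by (rule young_diagramD[OF that(1)]) simp_all
  qed
  show "\<forall>D\<in>symmetric_shapes (2 * n + 1). shrink (blow_up D) = D"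
    using shrink_blow_up by blast
  show inverse: "\<forall>E\<in>symmetric_odd_row_shapes (4 * n + 1). blow_up (shrink E) = E"
  proof
    fix E assume E: "E \<in> symmetric_odd_row_shapes (4 * n + 1)"
    show "blow_up (shrink E) = E"
      by (rule blow_up_shrink) (use E in \<open>auto simp: symmetric_odd_row_shapes_def\<close>)
  qed
  show "blow_up ` symmetric_shapes (2 * n + 1) \<subseteq> symmetric_odd_row_shapes (4 * n + 1)"
  proof (rule image_subsetI)
    fix D assume "D \<in> symmetric_shapes (2 * n + 1)"
    then have D: "young_diagram D" "prod.swap ` D = D" "sum box_number D = 2 * n + 1"
      by (simp_all add: symmetric_shapes_def)
    \<comment> \<open>The weight is odd, hence nonzero; a nonempty diagram contains the corner that
      the count of boxes relies on.\<close>
    then have "D \<noteq> {}" by auto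
    then have "card (blow_up D) = 4 * n + 1"
      using card_blow_up[OF young_diagram_finite[OF D(1)] corner[OF D(1)]] D(3) by simp
    then show "blow_up D \<in> symmetric_odd_row_shapes (4 * n + 1)"
      using odd_rows_blow_up[OF D(1)] young_diagram_blow_up[OF D(1)] swap_image_blow_up[OF D(2)]
      by (auto simp: symmetric_odd_row_shapes_def)
  qed
  show "shrink ` symmetric_odd_row_shapes (4 * n + 1) \<subseteq> symmetric_shapes (2 * n + 1)"
  proof (rule image_subsetI)
    fix E assume E': "E \<in> symmetric_odd_row_shapes (4 * n + 1)"
    then have E: "young_diagram E" "prod.swap ` E = E" "card E = 4 * n + 1"
      by (simp_all add: symmetric_odd_row_shapes_def)
    then have "E \<noteq> {}" by auto
    then have "(0, 0) \<in> shrink E" using corner[OF E(1)] by simp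
    \<comment> \<open>Counting the boxes of \<open>E\<close> as the doubled form of
      \<open>shrink E\<close> gives
      \<open>4 * n + 2 = 2 * sum box_number (shrink E)\<close>.\<close>
    then have "sum box_number (shrink E) = 2 * n + 1"
      using card_blow_up[OF young_diagram_finite[OF young_diagram_shrink[OF E(1)]]]
        bspec[OF inverse E'] E(3) by simp
    then show "shrink E \<in> symmetric_shapes (2 * n + 1)"
      using young_diagram_shrink[OF E(1)] swap_image_shrink[OF E(2)]
      by (simp add: symmetric_shapes_def)
  qed
qed

theorem theorem1:
  fixes n :: nat
  shows "card (self_conjugate_odd_ferrers_graphs (2 * n + 1)) =
         card (self_conjugate_odd_part_partitions (4 * n + 1))"
  using bij_betw_same_card[OF bij_betw_graphs_shapes, of "2 * n + 1"]
    bij_betw_same_card[OF bij_betw_blow_up, of n]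
    bij_betw_same_card[OF bij_betw_partitions_shapes, of "4 * n + 1"]
  by (simp only:)

end
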